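(* If $f:\{0,1\}^n\to\{-1,1\}$ is $\varepsilon$-far from linear, where $\varepsilon\in(0,1/2]$, and $k\ge2$ is even, then $$\Pr\left[\text{XorTest}_k(f)\text{ rejects}\right]\ \ge\ \frac{1-(1-2\varepsilon)^{k-1}}{2}\ \ge\ \min\left\{\frac14,\frac{k\varepsilon}{2}\right\}.$$
   Context: A function $f:\{0,1\}^n\to\{-1,1\}$ is linear if $f(x)\cdot f(y)=f(x\oplus y)$ for all $x,y\in\{0,1\}^n$ ($\oplus$ is bitwise XOR; this is the $\pm1$ encoding of Boolean values). $f$ is $\varepsilon$-far from linear if it differs from every linear function on at least an $\varepsilon$ fraction of the domain. $\text{XorTest}_k$ chooses $x_1,\dots,x_k\in\{0,1\}^n$ independently and uniformly at random (with replacement), sets $y=\bigoplus_{i\in[k]}x_i$, and accepts if $f(y)=\prod_{i\in[k]}f(x_i)$; otherwise it rejects. *)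

theory Defs
  imports "HOL-Probability.Probability" "HOL-Library.Z2"
begin

text \<open>
  An element of \<open>{0,1}^n\<close> is encoded as a function \<open>x :: nat \<Rightarrow> bit\<close> on the coordinates \<open>0, ..., n - 1\<close>,
  extended by \<open>0\<close>; this covers every \<open>n\<close>, including \<open>n = 0\<close>. Addition in the two-element field
  \<^typ>\<open>bit\<close> is XOR.
\<close>

definition cube :: "nat \<Rightarrow> (nat \<Rightarrow> bit) set" where
  "cube n = {x. \<forall>j\<ge>n. x j = 0}"

definition vxor :: "(nat \<Rightarrow> bit) \<Rightarrow> (nat \<Rightarrow> bit) \<Rightarrow> nat \<Rightarrow> bit" where
  "vxor x y = (\<lambda>j. x j + y j)"

definition big_vxor :: "(nat \<Rightarrow> nat \<Rightarrow> bit) \<Rightarrow> nat set \<Rightarrow> nat \<Rightarrow> bit" where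
  "big_vxor x I = (\<lambda>j. \<Sum>i\<in>I. x i j)"

text \<open>Only the values of \<open>f\<close> on \<open>cube n\<close> matter in the following definitions.\<close>

definition boolean_fun :: "nat \<Rightarrow> ((nat \<Rightarrow> bit) \<Rightarrow> real) \<Rightarrow> bool" where
  "boolean_fun n f \<longleftrightarrow> f \<in> cube n \<rightarrow> {-1, 1}"

definition linear_fun :: "nat \<Rightarrow> ((nat \<Rightarrow> bit) \<Rightarrow> real) \<Rightarrow> bool" where
  "linear_fun n f \<longleftrightarrow>
     boolean_fun n f \<and> (\<forall>x\<in>cube n. \<forall>y\<in>cube n. f x * f y = f (vxor x y))"

definition far_from_linear :: "nat \<Rightarrow> real \<Rightarrow> ((nat \<Rightarrow> bit) \<Rightarrow> real) \<Rightarrow> bool" where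
  "far_from_linear n \<epsilon> f \<longleftrightarrow>
     (\<forall>g. linear_fun n g \<longrightarrow>
        real (card {x \<in> cube n. f x \<noteq> g x}) / real (card (cube n)) \<ge> \<epsilon>)"

text \<open>
  The output distribution of the test, with \<open>True\<close> for acceptance. The second argument of
  \<^const>\<open>Pi_pmf\<close> is only the value of the sample tuple at indices outside \<open>{1..k}\<close>.
\<close>

definition xor_test :: "nat \<Rightarrow> nat \<Rightarrow> ((nat \<Rightarrow> bit) \<Rightarrow> real) \<Rightarrow> bool pmf" where
  "xor_test n k f =
     map_pmf (\<lambda>x. f (big_vxor x {1..k}) = (\<Prod>i\<in>{1..k}. f (x i)))
       (Pi_pmf {1..k} (\<lambda>_. 0) (\<lambda>_. pmf_of_set (cube n)))"

text \<open>
  \<^const>\<open>pmf_of_set\<close> is the uniform distribution only on finite nonempty sets; the cube is one.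
\<close>

lemma bij_betw_Pow_cube: "bij_betw (\<lambda>A j. of_bool (j \<in> A)) (Pow {..<n}) (cube n)"
proof (rule bij_betw_byWitness[where f' = "\<lambda>x. {j. x j = 1}"])
  show "(\<lambda>x. {j. x j = 1}) ` cube n \<subseteq> Pow {..<n}"
    by (force simp: cube_def not_less[symmetric])
qed (auto simp: cube_def fun_eq_iff)

lemma finite_cube: "finite (cube n)"
  using bij_betw_finite[OF bij_betw_Pow_cube] by simp

lemma card_cube: "card (cube n) = 2 ^ n"
  using bij_betw_same_card[OF bij_betw_Pow_cube, of n] by (simp add: card_Pow)

lemma cube_nonempty: "cube n \<noteq> {}"
  by (auto simp: cube_def)

lemma vxor_in_cube: "x \<in> cube n \<Longrightarrow> y \<in> cube n \<Longrightarrow> vxor x y \<in> cube n"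
  by (simp add: cube_def vxor_def)

lemma big_vxor_in_cube: "(\<And>i. i \<in> I \<Longrightarrow> x i \<in> cube n) \<Longrightarrow> big_vxor x I \<in> cube n"
  by (simp add: cube_def big_vxor_def)

end

theory Submission
  imports Defs
begin

text \<open>
  Each character \<open>walsh S\<close> is a linear function, so if \<open>f\<close> is \<open>\<epsilon>\<close>-far from linear, then every
  Fourier coefficient of \<open>f\<close> is at most \<open>1 - 2\<epsilon>\<close>. Expanding
  \<open>f (x\<^sub>1 + \<dots> + x\<^sub>k)\<close> in characters and using independence, the expectation of
  \<open>f (x\<^sub>1 + \<dots> + x\<^sub>k) * f x\<^sub>1 * \<dots> * f x\<^sub>k\<close> is the sum of the \<open>(k+1)\<close>-st powers of the
  coefficients. As \<open>k - 1\<close> is odd, \<open>(k-1)\<close>-st powers are monotone even at negative coefficients,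
  and Parseval bounds the sum by \<open>(1 - 2\<epsilon>)\<^bsup>k-1\<^esup>\<close>.
\<close>

section \<open>Products of independent samples\<close>

text \<open>Coordinates under \<open>Pi_pmf\<close> are independent with marginals
  \<open>p i\<close>. Integrability is assumed rather than nonnegativity because the factors used
  later, \<open>f y * walsh S y\<close>, can be negative.\<close>

lemma expectation_prod_Pi_pmf_real:
  fixes g :: "'a \<Rightarrow> 'b \<Rightarrow> real"
  assumes "finite I" and "\<And>i. i \<in> I \<Longrightarrow> integrable (measure_pmf (p i)) (g i)"
  shows "measure_pmf.expectation (Pi_pmf I d p) (\<lambda>x. \<Prod>i\<in>I. g i (x i)) =
         (\<Prod>i\<in>I. measure_pmf.expectation (p i) (g i))"
proof -
  let ?P = "measure_pmf (Pi_pmf I d p)"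
  have marginal: "map_pmf (\<lambda>x. x i) (Pi_pmf I d p) = p i" if "i \<in> I" for i
    using assms(1) that by (simp add: Pi_pmf_component)
  have int: "integrable ?P (\<lambda>x. g i (x i))" if "i \<in> I" for i
    using assms(2)[OF that] marginal[OF that]
    by (metis integrable_map_pmf_eq)
  have "prob_space.indep_vars ?P (\<lambda>_. borel) (\<lambda>i x. g i (x i)) I"
    by (rule prob_space.indep_vars_compose2[OF prob_space_measure_pmf indep_vars_Pi_pmf[OF assms(1)]]) auto
  then have "measure_pmf.expectation (Pi_pmf I d p) (\<lambda>x. \<Prod>i\<in>I. g i (x i)) =
      (\<Prod>i\<in>I. measure_pmf.expectation (Pi_pmf I d p) (\<lambda>x. g i (x i)))"
    by (intro prob_space.indep_vars_lebesgue_integral prob_space_measure_pmf assms(1) int)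
  also have "\<dots> = (\<Prod>i\<in>I. measure_pmf.expectation (p i) (g i))"
    using marginal by (intro prod.cong refl) (metis integral_map_pmf)
  finally show ?thesis .
qed

section \<open>Fourier analysis on the cube\<close>

definition bit_sign :: "bit \<Rightarrow> real" where
  "bit_sign b = (if b = 0 then 1 else -1)"

definition walsh :: "nat set \<Rightarrow> (nat \<Rightarrow> bit) \<Rightarrow> real" where
  "walsh S x = (\<Prod>j\<in>S. bit_sign (x j))"

text \<open>Normalised as an average over the cube, so that it is the expectation of
  \<open>f y * walsh S y\<close> for one uniform sample \<open>y\<close>.\<close>

definition fourier_coeff :: "nat \<Rightarrow> ((nat \<Rightarrow> bit) \<Rightarrow> real) \<Rightarrow> nat set \<Rightarrow> real" where
  "fourier_coeff n f S = (\<Sum>x\<in>cube n. f x * walsh S x) / 2 ^ n"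

lemma bit_sign_add: "bit_sign (a + b) = bit_sign a * bit_sign b"
  by (cases a; cases b) (simp_all add: bit_sign_def)

lemma bit_sign_sum: "bit_sign (\<Sum>i\<in>I. b i) = (\<Prod>i\<in>I. bit_sign (b i))"
proof (induction I rule: infinite_finite_induct)
  case (insert i I)
  then show ?case
    by (simp add: bit_sign_add del: add_bit_eq_xor)
qed (simp_all add: bit_sign_def)

lemma walsh_vxor: "walsh S (vxor x y) = walsh S x * walsh S y"
  by (simp add: walsh_def vxor_def bit_sign_add prod.distrib del: add_bit_eq_xor)

lemma walsh_big_vxor: "walsh S (big_vxor x I) = (\<Prod>i\<in>I. walsh S (x i))"
  unfolding walsh_def big_vxor_def bit_sign_sum by (rule prod.swap)

lemma walsh_values: "walsh S x \<in> {-1, 1}"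
  unfolding walsh_def
  by (induction S rule: infinite_finite_induct) (auto simp: bit_sign_def)

lemma linear_fun_walsh: "linear_fun n (walsh S)"
  using walsh_values by (auto simp: linear_fun_def boolean_fun_def walsh_vxor)

text \<open>The sum over subsets expands a product over the coordinates \<open>j < n\<close>, whose
  factor is 2 where \<open>x\<close> and \<open>y\<close> agree and 0 where they differ.\<close>

lemma walsh_orthogonal:
  assumes "x \<in> cube n" "y \<in> cube n"
  shows "(\<Sum>S\<in>Pow {..<n}. walsh S x * walsh S y) = (if x = y then 2 ^ n else 0)"
proof -
  have "(\<Sum>S\<in>Pow {..<n}. walsh S x * walsh S y) =
        (\<Sum>S\<in>Pow {..<n}. (\<Prod>j\<in>S. bit_sign (x j) * bit_sign (y j)) * (\<Prod>j\<in>{..<n} - S. 1))"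
    by (simp add: walsh_def prod.distrib)
  also have "\<dots> = (\<Prod>j<n. bit_sign (x j) * bit_sign (y j) + 1)"
    by (simp only: prod_add[OF finite_lessThan])
  also have "\<dots> = (if x = y then 2 ^ n else 0)"
  proof (cases "x = y")
    case True
    have "bit_sign b * bit_sign b + 1 = 2" for b
      by (simp add: bit_sign_def)
    with True show ?thesis by simp
  next
    case False
    then obtain j where j: "x j \<noteq> y j" by auto
    \<comment> \<open>Points of the cube are 0 from coordinate \<open>n\<close> on, so they can
      differ only below \<open>n\<close>.\<close>
    with assms have "j < n" by (force simp: cube_def not_less[symmetric])
    moreover from j have "bit_sign (x j) * bit_sign (y j) + 1 = 0"
      by (cases "x j"; cases "y j") (auto simp: bit_sign_def)
    ultimately show ?thesis using False by (auto simp: prod_zero_iff)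
  qed
  finally show ?thesis .
qed

lemma fourier_inversion:
  assumes "y \<in> cube n"
  shows "(\<Sum>S\<in>Pow {..<n}. fourier_coeff n f S * walsh S y) = f y"
proof -
  have "(\<Sum>S\<in>Pow {..<n}. fourier_coeff n f S * walsh S y) =
        (\<Sum>S\<in>Pow {..<n}. \<Sum>x\<in>cube n. f x * (walsh S x * walsh S y) / 2 ^ n)"
    by (simp add: fourier_coeff_def sum_distrib_right sum_distrib_left sum_divide_distrib mult_ac)
  also have "\<dots> = (\<Sum>x\<in>cube n. \<Sum>S\<in>Pow {..<n}. f x * (walsh S x * walsh S y) / 2 ^ n)"
    by (rule sum.swap)
  also have "\<dots> = (\<Sum>x\<in>cube n. f x * (\<Sum>S\<in>Pow {..<n}. walsh S x * walsh S y) / 2 ^ n)"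
    by (simp add: sum_distrib_left sum_divide_distrib)
  also have "\<dots> = (\<Sum>x\<in>cube n. if x = y then f x else 0)"
    using assms by (intro sum.cong refl) (simp add: walsh_orthogonal)
  also have "\<dots> = f y"
    using assms by (simp add: finite_cube)
  finally show ?thesis .
qed

text \<open>Only one factor of each square is unfolded; after exchanging the sums, the other factor
  lets inversion collapse the inner sum to \<open>f x\<close>.\<close>

lemma parseval:
  "(\<Sum>S\<in>Pow {..<n}. (fourier_coeff n f S)\<^sup>2) = (\<Sum>x\<in>cube n. (f x)\<^sup>2) / 2 ^ n"
proof -
  have "(\<Sum>S\<in>Pow {..<n}. (fourier_coeff n f S)\<^sup>2) =
        (\<Sum>S\<in>Pow {..<n}. fourier_coeff n f S * ((\<Sum>x\<in>cube n. f x * walsh S x) / 2 ^ n))"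
    by (simp add: power2_eq_square fourier_coeff_def)
  also have "\<dots> = (\<Sum>S\<in>Pow {..<n}. \<Sum>x\<in>cube n. f x * (fourier_coeff n f S * walsh S x) / 2 ^ n)"
    by (simp add: sum_distrib_left sum_divide_distrib mult_ac)
  also have "\<dots> = (\<Sum>x\<in>cube n. \<Sum>S\<in>Pow {..<n}. f x * (fourier_coeff n f S * walsh S x) / 2 ^ n)"
    by (rule sum.swap)
  also have "\<dots> = (\<Sum>x\<in>cube n. f x * (\<Sum>S\<in>Pow {..<n}. fourier_coeff n f S * walsh S x) / 2 ^ n)"
    by (simp add: sum_distrib_left sum_divide_distrib)
  also have "\<dots> = (\<Sum>x\<in>cube n. (f x)\<^sup>2) / 2 ^ n"
    by (simp add: fourier_inversion power2_eq_square sum_divide_distrib)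
  finally show ?thesis .
qed

text \<open>The product \<open>f x * walsh S x\<close> is 1 on agreement and -1 on disagreement, so
  the coefficient is 1 minus twice the distance to \<open>walsh S\<close>. The bound is one-sided: a
  coefficient may be as low as -1.\<close>

lemma fourier_coeff_le_of_far:
  assumes "boolean_fun n f" and "far_from_linear n \<epsilon> f"
  shows "fourier_coeff n f S \<le> 1 - 2 * \<epsilon>"
proof -
  let ?D = "{x \<in> cube n. f x \<noteq> walsh S x}"
  have "f x * walsh S x = 1 - 2 * of_bool (f x \<noteq> walsh S x)" if "x \<in> cube n" for x
    using assms(1) that walsh_values[of S x] by (auto simp: boolean_fun_def Pi_def)
  then have "(\<Sum>x\<in>cube n. f x * walsh S x) =
      (\<Sum>x\<in>cube n. 1 - 2 * of_bool (f x \<noteq> walsh S x))"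
    by (rule sum.cong[OF refl])
  also have "\<dots> = 2 ^ n - 2 * real (card ?D)"
    by (simp add: sum_subtractf card_cube finite_cube Int_def flip: sum_distrib_left)
  finally have "fourier_coeff n f S = 1 - 2 * (real (card ?D) / 2 ^ n)"
    by (simp add: fourier_coeff_def field_simps)
  moreover have "\<epsilon> \<le> real (card ?D) / 2 ^ n"
    using assms(2) linear_fun_walsh[of n S] by (simp add: far_from_linear_def card_cube)
  ultimately show ?thesis by simp
qed

section \<open>The rejection probability in terms of Fourier coefficients\<close>

lemma set_pmf_cube_samples:
  fixes k :: nat
  assumes "x \<in> set_pmf (Pi_pmf {1..k} d (\<lambda>_. pmf_of_set (cube n)))" and "i \<in> {1..k}"
  shows "x i \<in> cube n"
  using assms by (auto simp: set_Pi_pmf PiE_dflt_def finite_cube cube_nonempty)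

lemma finite_cube_samples:
  "finite (set_pmf (Pi_pmf {1..k::nat} d (\<lambda>_. pmf_of_set (cube n))))"
  by (auto simp: set_Pi_pmf finite_cube cube_nonempty intro!: finite_PiE_dflt)

text \<open>In the exponent, 1 comes from expanding \<open>f\<close> at the XOR and \<open>k\<close>
  from the samples, each of which contributes the same coefficient by independence.\<close>

lemma expectation_xor_product:
  "measure_pmf.expectation (Pi_pmf {1..k} d (\<lambda>_. pmf_of_set (cube n)))
     (\<lambda>x. f (big_vxor x {1..k}) * (\<Prod>i\<in>{1..k}. f (x i))) =
   (\<Sum>S\<in>Pow {..<n}. fourier_coeff n f S ^ (k + 1))"
proof -
  let ?U = "pmf_of_set (cube n)"
  let ?P = "Pi_pmf {1..k} d (\<lambda>_. ?U)"
  note [simp] = finite_cube cube_nonempty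
  have int: "integrable (measure_pmf ?P) h" for h :: "_ \<Rightarrow> real"
    by (rule integrable_measure_pmf_finite[OF finite_cube_samples])
  have "measure_pmf.expectation ?P (\<lambda>x. f (big_vxor x {1..k}) * (\<Prod>i\<in>{1..k}. f (x i))) =
      measure_pmf.expectation ?P
        (\<lambda>x. \<Sum>S\<in>Pow {..<n}. fourier_coeff n f S * (\<Prod>i\<in>{1..k}. f (x i) * walsh S (x i)))"
  \<comment> \<open>Inversion holds on the cube, so the integrands are compared only on the support,
    where all samples lie in the cube.\<close>
  proof (rule integral_cong_AE)
    show "AE x in ?P. f (big_vxor x {1..k}) * (\<Prod>i\<in>{1..k}. f (x i)) =
        (\<Sum>S\<in>Pow {..<n}. fourier_coeff n f S * (\<Prod>i\<in>{1..k}. f (x i) * walsh S (x i)))"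
      unfolding AE_measure_pmf_iff
    proof
      fix x assume x: "x \<in> set_pmf ?P"
      then have "big_vxor x {1..k} \<in> cube n"
        by (intro big_vxor_in_cube set_pmf_cube_samples)
      from fourier_inversion[OF this, of f]
      have "f (big_vxor x {1..k}) * (\<Prod>i\<in>{1..k}. f (x i)) =
        (\<Sum>S\<in>Pow {..<n}. fourier_coeff n f S * (\<Prod>i\<in>{1..k}. walsh S (x i))) * (\<Prod>i\<in>{1..k}. f (x i))"
        by (simp add: walsh_big_vxor)
      also have "\<dots> = (\<Sum>S\<in>Pow {..<n}. fourier_coeff n f S * (\<Prod>i\<in>{1..k}. f (x i) * walsh S (x i)))"
        by (simp add: sum_distrib_left prod.distrib mult_ac)
      finally show "f (big_vxor x {1..k}) * (\<Prod>i\<in>{1..k}. f (x i)) =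
        (\<Sum>S\<in>Pow {..<n}. fourier_coeff n f S * (\<Prod>i\<in>{1..k}. f (x i) * walsh S (x i)))" .
    qed
  qed simp_all
  also have "\<dots> = (\<Sum>S\<in>Pow {..<n}. fourier_coeff n f S *
      measure_pmf.expectation ?P (\<lambda>x. \<Prod>i\<in>{1..k}. f (x i) * walsh S (x i)))"
    by (subst Bochner_Integration.integral_sum) (simp_all only: int integral_mult_right_zero Bochner_Integration.integral_mult_right)
  also have "\<dots> = (\<Sum>S\<in>Pow {..<n}. fourier_coeff n f S * fourier_coeff n f S ^ k)"
  proof (intro sum.cong refl arg_cong2[where f = "(*)"])
    fix S
    have "measure_pmf.expectation ?P (\<lambda>x. \<Prod>i\<in>{1..k}. f (x i) * walsh S (x i)) =
      (\<Prod>i\<in>{1..k}. measure_pmf.expectation ?U (\<lambda>y. f y * walsh S y))"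
      by (intro expectation_prod_Pi_pmf_real integrable_measure_pmf_finite) simp_all
    then show "measure_pmf.expectation ?P (\<lambda>x. \<Prod>i\<in>{1..k}. f (x i) * walsh S (x i)) =
        fourier_coeff n f S ^ k"
      by (simp add: integral_pmf_of_set fourier_coeff_def card_cube)
  qed
  finally show ?thesis by simp
qed

text \<open>For signs \<open>a\<close> and \<open>b\<close>, the indicator of
  \<open>a \<noteq> b\<close> is \<open>(1 - a * b) / 2\<close>.\<close>

lemma pmf_xor_test_False:
  assumes "boolean_fun n f"
  shows "pmf (xor_test n k f) False = (1 - (\<Sum>S\<in>Pow {..<n}. fourier_coeff n f S ^ (k + 1))) / 2"
proof -
  let ?P = "Pi_pmf {1..k} (\<lambda>_. 0) (\<lambda>_. pmf_of_set (cube n))"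
  let ?R = "{x. f (big_vxor x {1..k}) \<noteq> (\<Prod>i\<in>{1..k}. f (x i))}"
  let ?h = "\<lambda>x. f (big_vxor x {1..k}) * (\<Prod>i\<in>{1..k}. f (x i))"
  have "pmf (xor_test n k f) False = measure_pmf.prob ?P ?R"
    by (simp add: xor_test_def pmf_map vimage_def)
  also have "\<dots> = measure_pmf.expectation ?P (indicator ?R)"
    by simp
  also have "\<dots> = measure_pmf.expectation ?P (\<lambda>x. (1 - ?h x) / 2)"
  proof (rule integral_cong_AE)
    show "AE x in ?P. indicator ?R x = (1 - ?h x) / 2"
      unfolding AE_measure_pmf_iff
    proof
      fix x assume x: "x \<in> set_pmf ?P"
      have pm: "f y \<in> {-1, 1}" if "y \<in> cube n" for y
        using assms that by (auto simp: boolean_fun_def)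
      have xor_sign: "f (big_vxor x {1..k}) \<in> {-1, 1}"
        using x by (intro pm big_vxor_in_cube set_pmf_cube_samples)
      have prods: "(\<Prod>i\<in>I. f (x i)) \<in> {-1, 1}" if "I \<subseteq> {1..k}" for I
        using finite_subset[OF that finite_atLeastAtMost] that
      proof (induction I rule: finite_induct)
        case (insert i I)
        have "f (x i) \<in> {-1, 1}"
          using insert.prems x by (intro pm set_pmf_cube_samples) auto
        with insert show ?case by auto
      qed simp
      from xor_sign prods[OF order_refl] show "indicator ?R x = (1 - ?h x) / 2"
        by (elim insertE emptyE) (simp_all add: indicator_def)
    qed
  qed simp_all
  also have "\<dots> = (1 - measure_pmf.expectation ?P ?h) / 2"
    using integrable_measure_pmf_finite[OF finite_cube_samples, where f = ?h] by simp
  finally show ?thesis by (simp only: expectation_xor_product)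
qed

text \<open>Of the \<open>m + 2\<close> factors, \<open>m\<close> are bounded by the largest
  possible coefficient and two are kept as a square for Parseval. Oddness of \<open>m\<close> makes
  the power monotone on all reals.\<close>

lemma sum_fourier_coeff_power_le:
  assumes "boolean_fun n f" and "far_from_linear n \<epsilon> f" and "odd m"
  shows "(\<Sum>S\<in>Pow {..<n}. fourier_coeff n f S ^ (m + 2)) \<le> (1 - 2 * \<epsilon>) ^ m"
proof -
  have "(\<Sum>S\<in>Pow {..<n}. fourier_coeff n f S ^ (m + 2)) \<le>
        (\<Sum>S\<in>Pow {..<n}. (1 - 2 * \<epsilon>) ^ m * (fourier_coeff n f S)\<^sup>2)"
    unfolding power_add
    using fourier_coeff_le_of_far[OF assms(1,2)] assms(3)
    by (intro sum_mono mult_right_mono power_mono_odd) auto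
  also have "\<dots> = (1 - 2 * \<epsilon>) ^ m * ((\<Sum>x\<in>cube n. (f x)\<^sup>2) / 2 ^ n)"
    by (simp add: parseval flip: sum_distrib_left)
  also have "(\<Sum>x\<in>cube n. (f x)\<^sup>2) = (\<Sum>x\<in>cube n. 1)"
    using assms(1) by (intro sum.cong refl) (auto simp: boolean_fun_def Pi_def)
  finally show ?thesis by (simp add: card_cube)
qed

section \<open>Elementary inequalities and the final bound\<close>

text \<open>The inverse of \<open>1 - 1 / k\<close> is \<open>1 + 1 / (k - 1)\<close>, whose power
  \<open>k - 1\<close> is at least 2 by Bernoulli.\<close>

lemma power_one_minus_recip_le_half:
  fixes k :: nat
  assumes "k \<ge> 2"
  shows "(1 - 1 / real k) ^ (k - 1) \<le> 1 / 2"
proof -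
  have "2 \<le> 1 + real (k - 1) * (1 / real (k - 1))"
    using assms by simp
  also have "\<dots> \<le> (1 + 1 / real (k - 1)) ^ (k - 1)"
    by (rule Bernoulli_inequality) (rule order_trans[of _ 0], simp_all)
  also have "1 + 1 / real (k - 1) = inverse (1 - 1 / real k)"
    using assms by (simp add: field_simps of_nat_diff)
  finally have "2 \<le> inverse ((1 - 1 / real k) ^ (k - 1))"
    by (simp add: power_inverse)
  moreover have "(1 - 1 / real k) ^ (k - 1) > 0"
    using assms by simp
  ultimately show ?thesis by (simp add: field_simps)
qed

text \<open>The two terms of the minimum meet at \<open>2 * \<epsilon> = 1 / k\<close>. Above this
  threshold the power is at most 1/2; below it, convexity gives the linear bound.\<close>

lemma one_minus_power_ge_min:
  fixes \<epsilon> :: real and k :: nat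
  assumes "0 \<le> \<epsilon>" and "\<epsilon> \<le> 1 / 2" and "k \<ge> 2"
  shows "min (1 / 4) (real k * \<epsilon> / 2) \<le> (1 - (1 - 2 * \<epsilon>) ^ (k - 1)) / 2"
proof (cases "1 / k \<le> 2 * \<epsilon>")
  case True
  then have "(1 - 2 * \<epsilon>) ^ (k - 1) \<le> (1 - 1 / k) ^ (k - 1)"
    using assms by (intro power_mono) auto
  with power_one_minus_recip_le_half[OF assms(3)] show ?thesis
    by (simp add: min_def)
next
  case False
  \<comment> \<open>Chosen so that \<open>1 - 2 * \<epsilon>\<close> is the convex combination of
    \<open>1\<close> and \<open>1 - 1 / k\<close> with weight \<open>t\<close> on the
    latter.\<close>
  define t where "t = 2 * real k * \<epsilon>"
  have t: "0 \<le> t" "t \<le> 1"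
    using False assms by (auto simp: t_def field_simps)
  \<comment> \<open>On \<open>[0, 1/(2k)]\<close> the convex function \<open>(1 - 2\<epsilon>)\<^bsup>k-1\<^esup>\<close> of \<open>\<epsilon>\<close> lies below its chord.\<close>
  have "convex_on {0..} (\<lambda>x::real. x ^ (k - 1))"
    by (cases "even (k - 1)") (auto intro: convex_on_subset[OF convex_power_even] convex_power_odd)
  from convex_onD[OF this t, of 1 "1 - 1 / k"]
  have "((1 - t) * 1 + t * (1 - 1 / k)) ^ (k - 1) \<le> (1 - t) + t * (1 - 1 / k) ^ (k - 1)"
    using assms by simp
  also have "(1 - t) * 1 + t * (1 - 1 / k) = 1 - 2 * \<epsilon>"
    using assms by (simp add: t_def field_simps)
  also have "t * (1 - 1 / k) ^ (k - 1) \<le> t * (1 / 2)"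
    using power_one_minus_recip_le_half[OF assms(3)] t(1) by (rule mult_left_mono)
  finally have "(1 - 2 * \<epsilon>) ^ (k - 1) \<le> 1 - real k * \<epsilon>"
    by (simp add: t_def mult.commute)
  then show ?thesis by (simp add: min_def)
qed

theorem lemma3p1:
  fixes n k :: nat and \<epsilon> :: real and f :: "(nat \<Rightarrow> bit) \<Rightarrow> real"
  assumes "boolean_fun n f"
    and "far_from_linear n \<epsilon> f"
    and "0 < \<epsilon>" and "\<epsilon> \<le> 1 / 2"
    and "k \<ge> 2" and "even k"
  shows "pmf (xor_test n k f) False \<ge> (1 - (1 - 2 * \<epsilon>) ^ (k - 1)) / 2
       \<and> (1 - (1 - 2 * \<epsilon>) ^ (k - 1)) / 2 \<ge> min (1 / 4) (real k * \<epsilon> / 2)"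
proof
  \<comment> \<open>Evenness of \<open>k\<close> enters here: \<open>k + 1\<close> splits into the
    odd exponent \<open>k - 1\<close> and the square.\<close>
  have "odd (k - 1)" and "k - 1 + 2 = k + 1"
    using assms(5,6) by auto
  then have "(\<Sum>S\<in>Pow {..<n}. fourier_coeff n f S ^ (k + 1)) \<le> (1 - 2 * \<epsilon>) ^ (k - 1)"
    using sum_fourier_coeff_power_le[OF assms(1,2), of "k - 1"] by simp
  then show "pmf (xor_test n k f) False \<ge> (1 - (1 - 2 * \<epsilon>) ^ (k - 1)) / 2"
    by (simp add: pmf_xor_test_False[OF assms(1)])
  show "(1 - (1 - 2 * \<epsilon>) ^ (k - 1)) / 2 \<ge> min (1 / 4) (real k * \<epsilon> / 2)"
    using assms by (intro one_minus_power_ge_min) auto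
qed

end
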